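(* Given an integer $b>0$, there exist integers $b_0\ge 1$, $a\ge 3$ and $m\ge 1$ such that $\mu(I_{a,m}^k)>\mu(I_{a,m}^{k+1})$ for all integers $k$ with $b_0\le k\le b_0+b-1$, and $\mu(I_{a,m}^k)<\mu(I_{a,m}^{k+1})$ for all integers $k\ge b_0+b$.
   Context: $K$ is a field and $\mu(L)$ denotes the minimal number of generators of a graded ideal $L$. For integers $a\ge 3$ and $m\ge 1$, $I_{a,m}=(x_1^{am},x_2^{am})(x_1^m,x_2^m)+(x_1,x_2)^{(a+2)m-1}\subset K[x_1,x_2]$. *)

theory Defs
  imports Complex_Main "HOL-Library.Poly_Mapping" "HOL-Library.Product_Plus" "HOL-Library.Set_Algebras"
begin

text \<open>A polynomial in two variables is the finitely supported map from exponent vectors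
  \<open>(i, j)\<close> to coefficients, with the convolution product of \<open>HOL-Library.Poly_Mapping\<close>.\<close>

type_synonym 'k poly2 = "(nat \<times> nat) \<Rightarrow>\<^sub>0 'k"

definition X1 :: "'k::field poly2"
  where "X1 = Poly_Mapping.single (1, 0) 1"

definition X2 :: "'k::field poly2"
  where "X2 = Poly_Mapping.single (0, 1) 1"

text \<open>A commutative ring as a module over itself: \<open>ideal.subspace\<close> is the predicate of being
  an ideal, and \<open>ideal.span S\<close> is the ideal generated by \<open>S\<close>.\<close>

global_interpretation ideal: module "(*) :: 'r::comm_ring_1 \<Rightarrow> 'r \<Rightarrow> 'r"
  by standard (simp_all add: algebra_simps)

text \<open>On the right-hand side, \<open>I * J\<close> is the set of products from \<open>HOL-Library.Set_Algebras\<close>.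
  The sum of two ideals is the sum \<open>I + J\<close> of sets from there.\<close>

definition ideal_prod :: "'r::comm_ring_1 set \<Rightarrow> 'r set \<Rightarrow> 'r set"
  where "ideal_prod I J = ideal.span (I * J)"

fun ideal_power :: "'r::comm_ring_1 set \<Rightarrow> nat \<Rightarrow> 'r set"
  where
    "ideal_power I 0 = UNIV"
  | "ideal_power I (Suc n) = ideal_prod I (ideal_power I n)"

text \<open>Meaningful for finitely generated ideals, hence for all ideals of a Noetherian ring.\<close>

definition min_gens :: "'r::comm_ring_1 set \<Rightarrow> nat"
  where "min_gens L = (LEAST n. \<exists>S. finite S \<and> card S = n \<and> ideal.span S = L)"

definition I_am :: "nat \<Rightarrow> nat \<Rightarrow> 'k::field poly2 set"
  where "I_am a m =
    ideal_prod (ideal.span {X1 ^ (a * m), X2 ^ (a * m)}) (ideal.span {X1 ^ m, X2 ^ m})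
    + ideal_power (ideal.span {X1, X2}) ((a + 2) * m - 1)"

end

theory Submission
  imports Defs
begin

text \<open>Let \<open>A\<^sub>k = {a i + j | i, j \<le> k}\<close> and \<open>N = (a + 1) k\<close>. The gaps of \<open>A\<^sub>k\<close> in \<open>{0..N}\<close> have
  length at most \<open>a\<close>, so in degree \<open>m N + m - 1\<close> the power \<open>I\<^sup>k\<close> contains all monomials, and
  its other generators are the monomials of degree \<open>m N\<close> with exponent \<open>(m s, m (N - s))\<close>,
  \<open>s \<in> A\<^sub>k\<close>, each of which divides exactly \<open>m\<close> monomials of degree \<open>m N + m - 1\<close>, no two
  of them the same one. Hence
  \<open>\<mu>(I\<^sup>k) = |A\<^sub>k| + m (N + 1 - |A\<^sub>k|)\<close>, where \<open>|A\<^sub>k| = (k + 1)\<^sup>2\<close> for \<open>k < a\<close> and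
  \<open>|A\<^sub>k| = N + 1\<close> for \<open>k \<ge> a - 1\<close>. For \<open>k + 1 < a\<close>
  \<open>\<mu>(I\<^sup>k) - \<mu>(I\<^sup>k\<^sup>+\<^sup>1) = (m - 1) (2 k + 3) - m (a + 1)\<close>, which for \<open>m > a + 2\<close> is positive
  exactly when \<open>2 k + 1 \<ge> a\<close>; take \<open>a = 2 b + 1\<close>.\<close>

section \<open>Ideals spanned by monomials\<close>

text \<open>Recording all exponents of an ideal, not only those of generators, turns products and
  sums of ideals into \<open>E + F\<close> and \<open>E \<union> F\<close>.\<close>

definition monomial_ideal :: "'a::comm_monoid_add set \<Rightarrow> ('a \<Rightarrow>\<^sub>0 'k::field) set"
  where "monomial_ideal E = {f. Poly_Mapping.keys f \<subseteq> E}"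

definition add_closed :: "'a::comm_monoid_add set \<Rightarrow> bool"
  where "add_closed E \<longleftrightarrow> (\<forall>e\<in>E. \<forall>d. e + d \<in> E)"

lemma add_closed_plus: "add_closed E \<Longrightarrow> add_closed (E + F)"
  unfolding add_closed_def
proof (intro ballI allI)
  fix e d assume E: "\<forall>e\<in>E. \<forall>d. e + d \<in> E" and "e \<in> E + F"
  then obtain x y where "e = x + y" "x \<in> E" "y \<in> F" by (auto elim: set_plus_elim)
  then have "e + d = (x + d) + y" by (simp add: ac_simps)
  then show "e + d \<in> E + F" using E \<open>x \<in> E\<close> \<open>y \<in> F\<close> by (auto intro: set_plus_intro)
qed

lemma add_closed_UNIV: "add_closed UNIV"
  by (simp add: add_closed_def)

lemma sum_single_lookup:
  "(\<Sum>k\<in>Poly_Mapping.keys f. Poly_Mapping.single k (Poly_Mapping.lookup f k)) = f"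
  by (rule poly_mapping_eqI)
    (simp add: lookup_sum lookup_single when_def in_keys_iff)

lemma subspace_monomial_ideal:
  assumes "add_closed E"
  shows "ideal.subspace (monomial_ideal E)"
proof (rule ideal.subspaceI)
  show "0 \<in> monomial_ideal E" by (simp add: monomial_ideal_def)
next
  fix x y :: "'a \<Rightarrow>\<^sub>0 'b" assume "x \<in> monomial_ideal E" "y \<in> monomial_ideal E"
  then show "x + y \<in> monomial_ideal E"
    using keys_add[of x y] by (auto simp: monomial_ideal_def)
next
  fix c x :: "'a \<Rightarrow>\<^sub>0 'b" assume "x \<in> monomial_ideal E"
  then show "c * x \<in> monomial_ideal E"
  proof -
    have "a + b \<in> E" if "b \<in> Poly_Mapping.keys x" for a b
      using that \<open>x \<in> monomial_ideal E\<close> assms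
      by (auto simp: monomial_ideal_def add_closed_def add.commute[of a])
    then show ?thesis using keys_mult[of c x] unfolding monomial_ideal_def by blast
  qed
qed

lemma monomial_ideal_subset:
  fixes L :: "('a::comm_monoid_add \<Rightarrow>\<^sub>0 'k::field) set"
  assumes L: "ideal.subspace L"
    and mon: "\<And>e c. e \<in> E \<Longrightarrow> Poly_Mapping.single e c \<in> L"
  shows "monomial_ideal E \<subseteq> L"
proof
  fix f :: "'a \<Rightarrow>\<^sub>0 'k" assume "f \<in> monomial_ideal E"
  then have "(\<Sum>k\<in>Poly_Mapping.keys f. Poly_Mapping.single k (Poly_Mapping.lookup f k)) \<in> L"
    by (intro ideal.subspace_sum[OF L]) (auto simp: monomial_ideal_def intro: mon)
  then show "f \<in> L" by (simp only: sum_single_lookup)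
qed

lemma span_monomials:
  "ideal.span ((\<lambda>e. Poly_Mapping.single e (1::'k::field)) ` B) = monomial_ideal (B + UNIV)"
proof
  have "b \<in> B + UNIV" if "b \<in> B" for b
    using set_plus_intro[OF that UNIV_I[of 0]] by simp
  moreover have "add_closed (B + (UNIV :: 'a set))"
    using add_closed_plus[OF add_closed_UNIV, of B] by (simp add: add.commute)
  ultimately show "ideal.span ((\<lambda>e. Poly_Mapping.single e (1::'k::field)) ` B)
      \<subseteq> monomial_ideal (B + UNIV)"
    by (intro ideal.span_minimal subspace_monomial_ideal) (auto simp: monomial_ideal_def)
next
  show "monomial_ideal (B + UNIV)
      \<subseteq> ideal.span ((\<lambda>e. Poly_Mapping.single e (1::'k::field)) ` B)"
  proof (rule monomial_ideal_subset[OF ideal.subspace_span])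
    fix e and c :: 'k assume "e \<in> B + UNIV"
    then obtain b d where "e = b + d" "b \<in> B" by (auto elim: set_plus_elim)
    then have "Poly_Mapping.single e c = Poly_Mapping.single d c * Poly_Mapping.single b 1"
      by (simp add: mult_single add.commute)
    with \<open>b \<in> B\<close> show "Poly_Mapping.single e c
        \<in> ideal.span ((\<lambda>e. Poly_Mapping.single e (1::'k::field)) ` B)"
      by (auto intro: ideal.span_scale ideal.span_base)
  qed
qed

text \<open>Closure of \<open>E\<close> passes to \<open>E + F\<close>, so the right side is an
  ideal containing all products; conversely, each of its terms is a product of two terms.\<close>

lemma ideal_prod_monomial_ideal:
  assumes "add_closed E"
  shows "ideal_prod (monomial_ideal E) (monomial_ideal F)
    = (monomial_ideal (E + F) :: ('a::comm_monoid_add \<Rightarrow>\<^sub>0 'k::field) set)"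
proof
  show "ideal_prod (monomial_ideal E) (monomial_ideal F)
    \<subseteq> (monomial_ideal (E + F) :: ('a \<Rightarrow>\<^sub>0 'k) set)"
    unfolding ideal_prod_def
  proof (rule ideal.span_minimal)
    show "monomial_ideal E * monomial_ideal F
        \<subseteq> (monomial_ideal (E + F) :: ('a \<Rightarrow>\<^sub>0 'k) set)"
    proof
      fix h :: "'a \<Rightarrow>\<^sub>0 'k" assume "h \<in> monomial_ideal E * monomial_ideal F"
      then obtain f g where "h = f * g" "f \<in> monomial_ideal E" "g \<in> monomial_ideal F"
        by (auto elim: set_times_elim)
      then show "h \<in> monomial_ideal (E + F)"
        using keys_mult[of f g] unfolding monomial_ideal_def by (blast intro: set_plus_intro)
    qed
  qed (intro subspace_monomial_ideal add_closed_plus assms)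
next
  show "(monomial_ideal (E + F) :: ('a \<Rightarrow>\<^sub>0 'k) set)
    \<subseteq> ideal_prod (monomial_ideal E) (monomial_ideal F)"
    unfolding ideal_prod_def
  proof (rule monomial_ideal_subset[OF ideal.subspace_span])
    fix e and c :: 'k assume "e \<in> E + F"
    then obtain x y where xy: "e = x + y" "x \<in> E" "y \<in> F" by (auto elim: set_plus_elim)
    then have "Poly_Mapping.single e c = Poly_Mapping.single x c * Poly_Mapping.single y 1"
      by (simp add: mult_single)
    also have "\<dots> \<in> monomial_ideal E * monomial_ideal F"
      using xy by (intro set_times_intro) (auto simp: monomial_ideal_def)
    finally show "Poly_Mapping.single e c \<in> ideal.span (monomial_ideal E * monomial_ideal F)"
      by (rule ideal.span_base)
  qed
qed

lemma plus_monomial_ideal: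
  "monomial_ideal E + monomial_ideal F
    = (monomial_ideal (E \<union> F) :: ('a::comm_monoid_add \<Rightarrow>\<^sub>0 'k::field) set)"
proof
  show "monomial_ideal E + monomial_ideal F \<subseteq> (monomial_ideal (E \<union> F) :: ('a \<Rightarrow>\<^sub>0 'k) set)"
  proof
    fix h :: "'a \<Rightarrow>\<^sub>0 'k" assume "h \<in> monomial_ideal E + monomial_ideal F"
    then obtain f g where "h = f + g" "f \<in> monomial_ideal E" "g \<in> monomial_ideal F"
      by (auto elim: set_plus_elim)
    then show "h \<in> monomial_ideal (E \<union> F)"
      using keys_add[of f g] by (auto simp: monomial_ideal_def)
  qed
next
  show "(monomial_ideal (E \<union> F) :: ('a \<Rightarrow>\<^sub>0 'k) set) \<subseteq> monomial_ideal E + monomial_ideal F"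
  proof
    fix f :: "'a \<Rightarrow>\<^sub>0 'k" assume f: "f \<in> monomial_ideal (E \<union> F)"
    \<comment> \<open>The terms of \<open>f\<close> with exponent in \<open>E\<close> form the first
      summand, the remaining ones the second.\<close>
    define part where
      "part A = (\<Sum>k\<in>A. Poly_Mapping.single k (Poly_Mapping.lookup f k))" for A
    have part: "part A \<in> monomial_ideal B" if "A \<subseteq> B" for A B
    proof -
      have "Poly_Mapping.keys (part A)
          \<subseteq> (\<Union>k\<in>A. Poly_Mapping.keys (Poly_Mapping.single k (Poly_Mapping.lookup f k)))"
        unfolding part_def by (rule keys_sum)
      also have "\<dots> \<subseteq> A" by auto
      finally show ?thesis using that by (simp add: monomial_ideal_def)
    qed
    have "Poly_Mapping.keys f
        = (Poly_Mapping.keys f \<inter> E) \<union> (Poly_Mapping.keys f - E)" by blast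
    then have "part (Poly_Mapping.keys f)
        = part (Poly_Mapping.keys f \<inter> E) + part (Poly_Mapping.keys f - E)"
      unfolding part_def by (subst sum.union_disjoint[symmetric]) (auto intro: sum.cong)
    moreover have "part (Poly_Mapping.keys f) = f"
      unfolding part_def by (simp only: sum_single_lookup)
    moreover have "part (Poly_Mapping.keys f \<inter> E) \<in> monomial_ideal E"
      "part (Poly_Mapping.keys f - E) \<in> monomial_ideal F"
      using f by (auto intro!: part simp: monomial_ideal_def[of "E \<union> F"])
    ultimately show "f \<in> monomial_ideal E + monomial_ideal F"
      by (metis set_plus_intro)
  qed
qed

section \<open>Minimal generators of monomial ideals\<close>

text \<open>A nonzero contribution to the convolution at \<open>g\<close> comes from some
  \<open>g = l + q\<close> with \<open>q \<in> E\<close>, and minimality of \<open>g\<close> forces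
  \<open>l = 0\<close>.\<close>

lemma lookup_mult_minimal:
  fixes p f :: "'a::comm_monoid_add \<Rightarrow>\<^sub>0 'k::field"
  assumes f: "f \<in> monomial_ideal E"
    and min: "\<And>u v. v \<in> E \<Longrightarrow> g = u + v \<Longrightarrow> u = 0"
  shows "Poly_Mapping.lookup (p * f) g = Poly_Mapping.lookup p 0 * Poly_Mapping.lookup f g"
proof -
  have "(\<Sum>q. Poly_Mapping.lookup f q when g = l + q)
      = (Poly_Mapping.lookup f g when l = 0)" for l :: 'a
  proof (cases "l = 0")
    case False
    then have "(Poly_Mapping.lookup f q when g = l + q) = 0" for q
      using f min[of q l] by (auto simp: monomial_ideal_def when_def in_keys_iff)
    then show ?thesis using False by simp
  qed (simp add: when_def)
  moreover have "(Poly_Mapping.lookup p l * Poly_Mapping.lookup f g when l = 0)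
      = (Poly_Mapping.lookup p 0 * Poly_Mapping.lookup f g when l = 0)" for l :: 'a
    by (simp add: when_def)
  ultimately have "Poly_Mapping.lookup (p * f) g
      = (\<Sum>l::'a. (Poly_Mapping.lookup p 0 * Poly_Mapping.lookup f g) when l = 0)"
    unfolding lookup_mult by (simp only: mult_when)
  then show ?thesis by simp
qed

text \<open>Graded Nakayama: reading off the coefficients at the minimal exponents \<open>G\<close> turns
  multiplication by \<open>p\<close> into scaling by the constant term of \<open>p\<close>, so it maps a generating set of
  the ideal to a spanning set of a vector space of dimension \<open>card G\<close>.\<close>

lemma card_minimal_le_card_generators:
  fixes S :: "('a::comm_monoid_add \<Rightarrow>\<^sub>0 'k::field) set"
  assumes E: "add_closed E" and G: "finite G" "G \<subseteq> E"
    and min: "\<And>g u v. g \<in> G \<Longrightarrow> v \<in> E \<Longrightarrow> g = u + v \<Longrightarrow> u = 0"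
    and S: "finite S" "ideal.span S = monomial_ideal E"
  shows "card G \<le> card S"
proof -
  \<comment> \<open>Field elements act as constant polynomials, whose exponent is
    \<open>0\<close>.\<close>
  interpret V: vector_space "\<lambda>(c::'k) (f::'a \<Rightarrow>\<^sub>0 'k). Poly_Mapping.single 0 c * f"
    by standard (simp_all add: distrib_left distrib_right single_add mult_single
        flip: mult.assoc)
  define \<phi> :: "('a \<Rightarrow>\<^sub>0 'k) \<Rightarrow> ('a \<Rightarrow>\<^sub>0 'k)"
    where "\<phi> f = (\<Sum>g\<in>G. Poly_Mapping.single g (Poly_Mapping.lookup f g))" for f
  define unit :: "'a \<Rightarrow> ('a \<Rightarrow>\<^sub>0 'k)" where "unit g = Poly_Mapping.single g 1" for g
  have inj: "inj_on unit G"
    by (auto simp: inj_on_def unit_def dest: arg_cong[of _ _ Poly_Mapping.keys])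
  have "V.independent (unit ` G)"
  proof (rule V.independent_if_scalars_zero)
    show "finite (unit ` G)" using G by simp
  next
    fix r h assume r: "(\<Sum>x\<in>unit ` G. Poly_Mapping.single 0 (r x) * x) = 0"
      and "h \<in> unit ` G"
    then obtain g where g: "g \<in> G" "h = unit g" by auto
    have "Poly_Mapping.single 0 c * unit x = Poly_Mapping.single x c" for c x
      by (simp add: unit_def mult_single)
    then have "(\<Sum>x\<in>G. Poly_Mapping.single x (r (unit x))) = 0"
      using r by (simp add: sum.reindex[OF inj])
    then have "(\<Sum>x\<in>G. Poly_Mapping.lookup (Poly_Mapping.single x (r (unit x))) g) = 0"
      by (metis lookup_sum lookup_zero)
    then show "r h = 0" using g G by (simp add: lookup_single when_def)
  qed
  moreover have span: "f \<in> monomial_ideal E \<and> \<phi> f \<in> V.span (\<phi> ` S)" if "f \<in> ideal.span S" for f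
    using that
  proof (induction rule: ideal.span_induct_alt)
    case base
    have "\<phi> 0 = 0" by (simp add: \<phi>_def)
    then show ?case by (simp add: V.span_zero monomial_ideal_def)
  next
    case (step c x y)
    then have x: "x \<in> monomial_ideal E" using S ideal.span_base by blast
    have "Poly_Mapping.lookup (c * x) g = Poly_Mapping.lookup c 0 * Poly_Mapping.lookup x g"
      if "g \<in> G" for g
      using lookup_mult_minimal[OF x min[OF that]] .
    then have "\<phi> (c * x + y) = Poly_Mapping.single 0 (Poly_Mapping.lookup c 0) * \<phi> x + \<phi> y"
      by (simp add: \<phi>_def lookup_add single_add sum.distrib sum_distrib_left mult_single)
    moreover have "Poly_Mapping.single 0 (Poly_Mapping.lookup c 0) * \<phi> x \<in> V.span (\<phi> ` S)"
      using step by (intro V.span_scale V.span_base) auto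
    moreover have "c * x + y \<in> monomial_ideal E"
      using step x subspace_monomial_ideal[OF E]
      by (auto intro: ideal.subspace_add ideal.subspace_scale)
    ultimately show ?case using step by (auto intro: V.span_add)
  qed
  \<comment> \<open>Each \<open>unit g\<close> lies in the ideal and is fixed by
    \<open>\<phi>\<close>, so these independent vectors lie in the span of the images of the
    generators.\<close>
  have "unit ` G \<subseteq> V.span (\<phi> ` S)"
  proof clarify
    fix g assume g: "g \<in> G"
    then have "Poly_Mapping.single g 1 \<in> ideal.span S"
      using G S by (auto simp: monomial_ideal_def)
    moreover have "\<phi> (Poly_Mapping.single g 1) = unit g"
    proof -
      have "\<phi> (Poly_Mapping.single g 1) = (\<Sum>x\<in>G. if x = g then unit g else 0)"
        unfolding \<phi>_def unit_def by (intro sum.cong) (auto simp: lookup_single when_def)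
      then show ?thesis using g G by simp
    qed
    ultimately show "unit g \<in> V.span (\<phi> ` S)" using span by metis
  qed
  ultimately have "card (unit ` G) \<le> card (\<phi> ` S)"
    using V.independent_span_bound[of "\<phi> ` S" "unit ` G"] S(1) by blast
  also have "\<dots> \<le> card S" using S(1) by (rule card_image_le)
  finally show ?thesis by (simp add: card_image inj)
qed

text \<open>The monomials with exponents in \<open>G\<close> attain the lower bound from graded
  Nakayama.\<close>

lemma min_gens_monomial_ideal:
  assumes G: "finite G"
    and min: "\<And>g u v. g \<in> G \<Longrightarrow> v \<in> G + UNIV \<Longrightarrow> g = u + v \<Longrightarrow> u = 0"
  shows "min_gens (monomial_ideal (G + UNIV) :: ('a::comm_monoid_add \<Rightarrow>\<^sub>0 'k::field) set) = card G"
  unfolding min_gens_def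
proof (rule Least_equality)
  have "inj (\<lambda>e::'a. Poly_Mapping.single e (1::'k))"
    by (auto simp: inj_on_def dest: arg_cong[of _ _ Poly_Mapping.keys])
  then show "\<exists>S :: ('a \<Rightarrow>\<^sub>0 'k) set. finite S \<and> card S = card G
      \<and> ideal.span S = monomial_ideal (G + UNIV)"
    using G span_monomials[of G, where 'k = 'k]
    by (intro exI[of _ "(\<lambda>e. Poly_Mapping.single e 1) ` G"])
      (auto intro: card_image inj_on_subset)
next
  fix n assume "\<exists>S :: ('a \<Rightarrow>\<^sub>0 'k) set. finite S \<and> card S = n
      \<and> ideal.span S = monomial_ideal (G + UNIV)"
  moreover have "add_closed (G + UNIV)"
    using add_closed_plus[OF add_closed_UNIV, of G] by (simp add: add.commute)
  moreover have "G \<subseteq> G + UNIV"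
    using set_plus_intro[OF _ UNIV_I[of 0]] by fastforce
  ultimately show "card G \<le> n"
    using card_minimal_le_card_generators[OF _ G, of "G + UNIV"] min by blast
qed


section \<open>Monomial ideals in two variables\<close>

lemma mem_plus_UNIV_iff:
  "(p, q) \<in> B + (UNIV :: (nat \<times> nat) set) \<longleftrightarrow> (\<exists>(i, j)\<in>B. i \<le> p \<and> j \<le> q)"
proof
  assume "(p, q) \<in> B + UNIV"
  then obtain i j d e where "(p, q) = (i, j) + (d, e)" "(i, j) \<in> B"
    by (metis set_plus_elim surj_pair)
  then show "\<exists>(i, j)\<in>B. i \<le> p \<and> j \<le> q" by (intro bexI[of _ "(i, j)"]) auto
next
  assume "\<exists>(i, j)\<in>B. i \<le> p \<and> j \<le> q"
  then obtain i j where "(i, j) \<in> B" "i \<le> p" "j \<le> q" by auto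
  then have "(p, q) = (i, j) + (p - i, q - j)" by simp
  then show "(p, q) \<in> B + UNIV" using \<open>(i, j) \<in> B\<close> by (metis UNIV_I set_plus_intro)
qed

lemma X1_power: "(X1 :: 'k::field poly2) ^ n = Poly_Mapping.single (n, 0) 1"
  by (induction n) (simp_all add: X1_def mult_single flip: zero_prod_def)

lemma X2_power: "(X2 :: 'k::field poly2) ^ n = Poly_Mapping.single (0, n) 1"
  by (induction n) (simp_all add: X2_def mult_single flip: zero_prod_def)

lemma span_powers:
  "ideal.span {X1 ^ n, X2 ^ n} = (monomial_ideal {(p, q). n \<le> p \<or> n \<le> q} :: 'k::field poly2 set)"
proof -
  have "{(n, 0), (0, n)} + UNIV = {(p, q). n \<le> p \<or> n \<le> q}"
    by (auto simp: mem_plus_UNIV_iff)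
  then show ?thesis
    using span_monomials[of "{(n, 0), (0, n)}", where 'k = 'k] by (simp add: X1_power X2_power)
qed

text \<open>In the induction step, an exponent of degree above \<open>n\<close> has a positive
  coordinate, and lowering it by one leaves degree at least \<open>n\<close>.\<close>

lemma maximal_ideal_power:
  "ideal_power (ideal.span {X1, X2}) n
    = (monomial_ideal {(p, q). n \<le> p + q} :: 'k::field poly2 set)"
proof (induction n)
  case 0
  then show ?case by (simp add: monomial_ideal_def)
next
  case (Suc n)
  have sum: "{(p, q). (1::nat) \<le> p \<or> (1::nat) \<le> q} + {(p, q). n \<le> p + q} = {(p, q). Suc n \<le> p + q}"
    (is "?A + ?B = ?C")
  proof
    show "?A + ?B \<subseteq> ?C" by (auto elim!: set_plus_elim)
  next
    show "?C \<subseteq> ?A + ?B"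
    proof clarify
      fix p q assume pq: "Suc n \<le> p + q"
      show "(p, q) \<in> ?A + ?B"
      proof (cases p)
        case 0
        then have "(p, q) = (0, 1) + (p, q - 1)" using pq by simp
        moreover have "(0, 1) \<in> ?A" "(p, q - 1) \<in> ?B" using pq 0 by auto
        ultimately show ?thesis by (metis set_plus_intro)
      next
        case (Suc p')
        then have "(p, q) = (1, 0) + (p', q)" by simp
        moreover have "(1, 0) \<in> ?A" "(p', q) \<in> ?B" using pq Suc by auto
        ultimately show ?thesis by (metis set_plus_intro)
      qed
    qed
  qed
  have "ideal.span {X1, X2} = (monomial_ideal ?A :: 'k poly2 set)"
    using span_powers[of 1, where 'k = 'k] by simp
  moreover have "add_closed ?A" by (auto simp: add_closed_def)
  ultimately show ?case
    unfolding ideal_power.simps Suc by (simp only: ideal_prod_monomial_ideal sum)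
qed

section \<open>Exponents of the powers of \<open>I_am a m\<close>\<close>

text \<open>This is the \<open>k\<close>-fold sumset of \<open>{0, 1, a, a + 1}\<close>; times
  \<open>m\<close>, these four numbers are the \<open>X1\<close>-exponents of the four products
  generating the first summand of \<open>I_am a m\<close>.\<close>

definition grid :: "nat \<Rightarrow> nat \<Rightarrow> nat set"
  where "grid a k = {a * i + j | i j. i \<le> k \<and> j \<le> k}"

text \<open>The first disjunct collects the multiples of \<open>k\<close>-fold products of those
  four monomials, the second everything from degree \<open>m * ((a + 1) * k + 1) - 1\<close> on; the
  \<open>+ 1\<close> on the right avoids truncated subtraction.\<close>

definition exponents :: "nat \<Rightarrow> nat \<Rightarrow> nat \<Rightarrow> (nat \<times> nat) set"
  where "exponents a m k = {(p, q).
    (\<exists>s\<in>grid a k. m * s \<le> p \<and> m * ((a + 1) * k - s) \<le> q) \<or> m * ((a + 1) * k + 1) \<le> p + q + 1}"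

lemma grid_eq_image: "grid a k = (\<lambda>(i, j). a * i + j) ` ({..k} \<times> {..k})"
  by (auto simp: grid_def)

lemma grid_le: "s \<in> grid a k \<Longrightarrow> s \<le> (a + 1) * k"
  unfolding grid_def using mult_le_mono2[of _ k a] by (auto simp: add.commute intro!: add_mono)

text \<open>The coefficients \<open>i\<close> and \<open>j\<close> split independently into a part
  at most \<open>1\<close> and a part at most \<open>k\<close>.\<close>

lemma grid_Suc: "grid a (Suc k) = grid a 1 + grid a k"
proof
  show "grid a 1 + grid a k \<subseteq> grid a (Suc k)"
  proof (clarsimp simp: grid_def elim!: set_plus_elim)
    fix i j i' j' assume "i \<le> Suc 0" "j \<le> Suc 0" "i' \<le> k" "j' \<le> k"
    then show "\<exists>i'' j''. a * i + j + (a * i' + j') = a * i'' + j'' \<and> i'' \<le> Suc k \<and> j'' \<le> Suc k"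
      by (intro exI[of _ "i + i'"] exI[of _ "j + j'"]) (simp add: algebra_simps)
  qed
next
  have split: "\<exists>i1 i2. i = i1 + i2 \<and> i1 \<le> 1 \<and> i2 \<le> k" if "i \<le> Suc k" for i
    using that by (cases i) (auto intro: exI[of _ 0] exI[of _ 1])
  show "grid a (Suc k) \<subseteq> grid a 1 + grid a k"
  proof
    fix s assume "s \<in> grid a (Suc k)"
    then obtain i j where s: "s = a * i + j" "i \<le> Suc k" "j \<le> Suc k" by (auto simp: grid_def)
    obtain i1 i2 j1 j2 where ij: "i = i1 + i2" "i1 \<le> 1" "i2 \<le> k" "j = j1 + j2" "j1 \<le> 1" "j2 \<le> k"
      using split s by metis
    have "s = (a * i1 + j1) + (a * i2 + j2)" using s ij by (simp add: algebra_simps)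
    moreover have "a * i1 + j1 \<in> grid a 1" "a * i2 + j2 \<in> grid a k"
      using ij by (auto simp: grid_def)
    ultimately show "s \<in> grid a 1 + grid a k" by (metis set_plus_intro)
  qed
qed

text \<open>Up to \<open>a * k\<close> the multiples of \<open>a\<close> are in the grid; beyond
  that, \<open>i = k\<close> reaches every \<open>t\<close>.\<close>

lemma grid_gap:
  assumes "t \<le> (a + 1) * k" "a \<ge> 1"
  shows "\<exists>s\<in>grid a k. s \<le> t \<and> t \<le> s + a"
proof (cases "t \<le> a * k")
  case True
  then have "t div a \<le> k" using div_le_mono[of t "a * k" a] assms by simp
  then have "a * (t div a) + 0 \<in> grid a k" unfolding grid_def by blast
  moreover have "t \<le> a * (t div a) + a"
    using assms mod_less_divisor[of a t] mult_div_mod_eq[of a t] by linarith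
  ultimately show ?thesis by (intro bexI[of _ "a * (t div a) + 0"]) auto
next
  case False
  then have "a * k + (t - a * k) \<in> grid a k"
    using assms unfolding grid_def by fastforce
  then show ?thesis using False by (intro bexI[of _ t]) auto
qed

lemma grid_subset_atMost: "grid a k \<subseteq> {..(a + 1) * k}"
  using grid_le by auto

lemma finite_grid: "finite (grid a k)"
  using grid_subset_atMost finite_subset by blast

text \<open>For \<open>k < a\<close>, \<open>i\<close> and \<open>j\<close> are quotient and
  remainder modulo \<open>a\<close>, so no two pairs collide.\<close>

lemma card_grid_small:
  assumes "k < a"
  shows "card (grid a k) = (k + 1)\<^sup>2"
proof -
  have "inj_on (\<lambda>(i, j). a * i + j) ({..k} \<times> {..k})"
  proof (rule inj_onI, clarsimp)
    fix i j i' j' assume *: "j \<le> k" "j' \<le> k" "a * i + j = a * i' + j'"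
    then have "(a * i + j) div a = (a * i' + j') div a" by simp
    moreover have "a \<noteq> 0" "j < a" "j' < a" using * assms by auto
    ultimately have "i = i'" by simp
    then show "i = i' \<and> j = j'" using * by simp
  qed
  then show ?thesis by (simp add: grid_eq_image card_image power2_eq_square)
qed

text \<open>Once \<open>k\<close> reaches \<open>a - 1\<close>, every remainder modulo
  \<open>a\<close> is available as \<open>j\<close>; above \<open>a * k\<close>, take
  \<open>i = k\<close>.\<close>

lemma card_grid_large:
  assumes "a \<le> k + 1" "a \<ge> 1"
  shows "card (grid a k) = (a + 1) * k + 1"
proof -
  have "t \<in> grid a k" if t: "t \<le> (a + 1) * k" for t
  proof (cases "t \<le> a * k")
    case True
    then have "t div a \<le> k" using div_le_mono[of t "a * k" a] assms by simp
    moreover have "t mod a \<le> k" using mod_less_divisor[of a t] assms by linarith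
    moreover have "t = a * (t div a) + t mod a" by simp
    ultimately show ?thesis unfolding grid_def by blast
  next
    case False
    then have "t = a * k + (t - a * k)" "t - a * k \<le> k" using t by auto
    then show ?thesis unfolding grid_def by blast
  qed
  then have "grid a k = {..(a + 1) * k}" using grid_le by auto
  then show ?thesis by simp
qed

lemma add_closed_exponents: "add_closed (exponents a m k)"
  unfolding add_closed_def exponents_def by (fastforce intro: trans_le_add1)

lemma exponents_0: "m \<ge> 1 \<Longrightarrow> exponents a m 0 = UNIV"
  by (auto simp: exponents_def grid_def)

lemma exponents_degree:
  assumes "(p, q) \<in> exponents a m k" "m \<ge> 1"
  shows "m * ((a + 1) * k) \<le> p + q"
proof -
  consider s where "s \<in> grid a k" "m * s \<le> p" "m * ((a + 1) * k - s) \<le> q"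
    | "m * ((a + 1) * k + 1) \<le> p + q + 1"
    using assms by (auto simp: exponents_def)
  then show ?thesis
  proof cases
    case 1
    have "m * ((a + 1) * k) = m * s + m * ((a + 1) * k - s)"
      using grid_le[OF 1(1)] by (simp flip: distrib_left)
    then show ?thesis using 1 by linarith
  next
    case 2
    then show ?thesis using assms by simp
  qed
qed

lemma I_am_eq:
  assumes "m \<ge> 1"
  shows "I_am a m = (monomial_ideal (exponents a m 1) :: 'k::field poly2 set)"
proof -
  let ?C = "\<lambda>n. {(p, q). (n::nat) \<le> p \<or> n \<le> q}"
  have "{..1::nat} = {0, 1}" by auto
  then have grid1: "grid a 1 = {0, 1, a, a + 1}"
    unfolding grid_eq_image by (auto simp: insert_Times_insert)
  have corner: "?C n = {(n, 0), (0, n)} + UNIV" for n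
    by (auto simp: mem_plus_UNIV_iff)
  have UU: "UNIV + UNIV = (UNIV :: (nat \<times> nat) set)"
    using set_plus_intro[of 0 UNIV _ UNIV] by fastforce
  \<comment> \<open>Both factors are upward closures of corner points, so only the corners have to
    be added.\<close>
  have "?C (a * m) + ?C m
      = ({(a * m, 0), (0, a * m)} + {(m, 0), (0, m)}) + (UNIV + UNIV)"
    unfolding corner by (simp only: ac_simps)
  also have "{(a * m, 0), (0, a * m)} + {(m, 0), (0, m)}
      = {(a * m + m, 0), (a * m, m), (m, a * m), (0, a * m + m)}"
    by (auto simp: set_plus_def)
  finally have sum: "?C (a * m) + ?C m
      = {(a * m + m, 0), (a * m, m), (m, a * m), (0, a * m + m)} + UNIV"
    unfolding UU .
  have "(p, q) \<in> ?C (a * m) + ?C m \<union> {(p, q). (a + 2) * m - 1 \<le> p + q}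
      \<longleftrightarrow> (p, q) \<in> exponents a m 1" for p q
  proof -
    have "(a + 2) * m - 1 \<le> p + q \<longleftrightarrow> m * (a + 2) \<le> p + q + 1"
      by (simp add: mult.commute[of m] le_diff_conv)
    then show ?thesis
      unfolding sum Un_iff mem_plus_UNIV_iff exponents_def grid1
      by (simp add: algebra_simps) blast
  qed
  then have "?C (a * m) + ?C m \<union> {(p, q). (a + 2) * m - 1 \<le> p + q} = exponents a m 1"
    by (intro set_eqI) (metis surj_pair)
  moreover have "add_closed (?C (a * m))" by (auto simp: add_closed_def)
  ultimately show ?thesis
    unfolding I_am_def span_powers maximal_ideal_power
    by (simp only: ideal_prod_monomial_ideal plus_monomial_ideal)
qed

text \<open>The crucial inclusion is the second: an exponent of high degree must lie above a grid
  exponent for \<open>k\<close>, and this is where the gap bound enters.\<close>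

lemma exponents_Suc:
  assumes "m \<ge> 1" "a \<ge> 1"
  shows "exponents a m 1 + exponents a m k = exponents a m (Suc k)"
proof
  show "exponents a m 1 + exponents a m k \<subseteq> exponents a m (Suc k)"
  proof
    fix x assume "x \<in> exponents a m 1 + exponents a m k"
    then obtain p q p' q' where x: "x = (p + p', q + q')"
      and pq: "(p, q) \<in> exponents a m 1" and pq': "(p', q') \<in> exponents a m k"
      by (auto elim!: set_plus_elim)
    show "x \<in> exponents a m (Suc k)"
    \<comment> \<open>If one summand has high degree, the lowest possible degree of the other
      suffices; otherwise the two grid elements add up.\<close>
    proof (cases "m * ((a + 1) * 1 + 1) \<le> p + q + 1 \<or> m * ((a + 1) * k + 1) \<le> p' + q' + 1")
      case True
      then have "m * ((a + 1) * Suc k + 1) \<le> (p + p') + (q + q') + 1"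
        using exponents_degree[OF pq] exponents_degree[OF pq'] assms by (auto simp: algebra_simps)
      then show ?thesis by (simp add: x exponents_def)
    next
      case False
      then obtain s s' where s: "s \<in> grid a 1" "m * s \<le> p" "m * ((a + 1) * 1 - s) \<le> q"
        and s': "s' \<in> grid a k" "m * s' \<le> p'" "m * ((a + 1) * k - s') \<le> q'"
        using pq pq' by (auto simp: exponents_def)
      have "(a + 1) * Suc k - (s + s') = ((a + 1) * 1 - s) + ((a + 1) * k - s')"
        using grid_le[OF s(1)] grid_le[OF s'(1)] by simp
      then have "m * ((a + 1) * Suc k - (s + s')) \<le> q + q'"
        using s s' by (simp only: distrib_left add_mono)
      moreover have "m * (s + s') \<le> p + p'" using s s' by (simp add: distrib_left)
      moreover have "s + s' \<in> grid a (Suc k)" unfolding grid_Suc using s s' by blast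
      ultimately show ?thesis unfolding x exponents_def by blast
    qed
  qed
next
  show "exponents a m (Suc k) \<subseteq> exponents a m 1 + exponents a m k"
  proof clarify
    fix p q assume "(p, q) \<in> exponents a m (Suc k)"
    then consider s where "s \<in> grid a (Suc k)" "m * s \<le> p" "m * ((a + 1) * Suc k - s) \<le> q"
      | "m * ((a + 1) * Suc k + 1) \<le> p + q + 1"
      by (auto simp: exponents_def)
    then show "(p, q) \<in> exponents a m 1 + exponents a m k"
    proof cases
      case 1
      then obtain s1 s2 where s: "s = s1 + s2" "s1 \<in> grid a 1" "s2 \<in> grid a k"
        unfolding grid_Suc by (auto elim: set_plus_elim)
      have "(a + 1) * Suc k - s = ((a + 1) * 1 - s1) + ((a + 1) * k - s2)"
        using grid_le[OF s(2)] grid_le[OF s(3)] s(1) by simp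
      then have q: "m * ((a + 1) * 1 - s1) + m * ((a + 1) * k - s2) \<le> q"
        using 1 by (simp only: distrib_left)
      have p: "m * s1 + m * s2 \<le> p" using 1 s by (simp add: distrib_left)
      have "(m * s1, m * ((a + 1) * 1 - s1)) \<in> exponents a m 1"
        unfolding exponents_def using s by blast
      moreover have "(p - m * s1, q - m * ((a + 1) * 1 - s1)) \<in> exponents a m k"
        unfolding exponents_def using s p q by (auto intro!: bexI[of _ s2])
      moreover have "(p, q) = (m * s1, m * ((a + 1) * 1 - s1))
          + (p - m * s1, q - m * ((a + 1) * 1 - s1))"
        using p q by simp
      ultimately show ?thesis by (metis set_plus_intro)
    next
      case 2
      define N where "N = (a + 1) * k"
      \<comment> \<open>Subtracting such a pair of degree \<open>m * N\<close> leaves degree at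
        least \<open>m * (a + 2) - 1\<close>, which puts the rest into
        \<open>exponents a m 1\<close>.\<close>
      have "\<exists>s\<in>grid a k. m * s \<le> p \<and> m * (N - s) \<le> q"
      proof (cases "p div m \<le> N")
        case True
        then obtain s where s: "s \<in> grid a k" "s \<le> p div m" "p div m \<le> s + a"
          using grid_gap assms unfolding N_def by blast
        \<comment> \<open>The gap bound gives \<open>p < m * (s + a + 1)\<close>, so the degree
          bound leaves at least \<open>m * (N - s)\<close> for \<open>q\<close>.\<close>
        have "p + 1 \<le> m * (p div m + 1)"
          using dividend_less_times_div[of m p] assms by simp
        also have "\<dots> \<le> m * (s + a + 1)" using s by (intro mult_le_mono2) simp
        finally have "p + 1 \<le> m * (s + a + 1)" .
        moreover have "m * (N - s) + m * (s + a + 1) = m * (N + a + 1)"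
          using grid_le[OF s(1)] unfolding N_def[symmetric] by (simp flip: distrib_left)
        moreover have "m * (N + a + 1) \<le> p + q + 1"
          using 2 unfolding N_def by (simp add: algebra_simps)
        ultimately have "m * (N - s) \<le> q" by linarith
        moreover have "m * s \<le> p" using s(2) by (metis div_times_less_eq_dividend
              le_trans mult.commute mult_le_mono2)
        ultimately show ?thesis using s(1) by blast
      next
        case False
        have "N \<in> grid a k" unfolding grid_def N_def by (auto intro!: exI[of _ k])
        moreover have "m * N \<le> p"
          using False by (metis div_times_less_eq_dividend le_trans mult.commute
              mult_le_mono2 nat_le_linear)
        ultimately show ?thesis by (intro bexI[of _ N]) auto
      qed
      then obtain s where s: "s \<in> grid a k" "m * s \<le> p" "m * (N - s) \<le> q" by blast
      have "m * s + m * (N - s) = m * N"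
        using grid_le[OF s(1)] unfolding N_def[symmetric] by (simp flip: distrib_left)
      then have "m * ((a + 1) * 1 + 1) \<le> (p - m * s) + (q - m * (N - s)) + 1"
        using 2 s unfolding N_def by (simp add: algebra_simps)
      then have "(p - m * s, q - m * (N - s)) \<in> exponents a m 1"
        unfolding exponents_def by blast
      moreover have "(m * s, m * (N - s)) \<in> exponents a m k"
        unfolding exponents_def N_def using s by blast
      moreover have "(p, q) = (p - m * s, q - m * (N - s)) + (m * s, m * (N - s))"
        using s by simp
      ultimately show ?thesis by (metis set_plus_intro)
    qed
  qed
qed

lemma ideal_power_I_am:
  assumes "m \<ge> 1" "a \<ge> 1"
  shows "ideal_power (I_am a m) k = (monomial_ideal (exponents a m k) :: 'k::field poly2 set)"
proof (induction k)
  case 0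
  then show ?case using assms by (simp add: exponents_0 monomial_ideal_def)
next
  case (Suc k)
  then show ?case
    by (simp only: ideal_power.simps I_am_eq[OF assms(1)] ideal_prod_monomial_ideal
        add_closed_exponents exponents_Suc[OF assms])
qed

section \<open>Counting the minimal generators\<close>

text \<open>The numbers with quotient \<open>s\<close> form a block of length \<open>m\<close>;
  these blocks cause the factor \<open>m\<close> in the count.\<close>

lemma div_mem_eq_image:
  assumes "m \<ge> 1"
  shows "{p::nat. p div m \<in> B} = (\<lambda>(s, r). m * s + r) ` (B \<times> {..<m})"
proof -
  have "p \<in> (\<lambda>(s, r). m * s + r) ` (B \<times> {..<m})" if "p div m \<in> B" for p
    using that assms by (intro image_eqI[of _ _ "(p div m, p mod m)"]) auto
  then show ?thesis by auto
qed

lemma finite_div_mem: "m \<ge> 1 \<Longrightarrow> finite B \<Longrightarrow> finite {p::nat. p div m \<in> B}"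
  by (simp add: div_mem_eq_image)

lemma card_div_mem:
  assumes "m \<ge> 1"
  shows "card {p::nat. p div m \<in> B} = m * card B"
proof -
  have "inj_on (\<lambda>(s, r). m * s + r) (B \<times> {..<m})"
  proof (rule inj_onI, clarsimp)
    fix s r s' r' assume *: "r < m" "r' < m" "m * s + r = m * s' + r'"
    then have "(m * s + r) div m = (m * s' + r') div m" by simp
    moreover have "m \<noteq> 0" "r < m" "r' < m" using * by auto
    ultimately have "s = s'" by simp
    then show "s = s' \<and> r = r'" using * by simp
  qed
  then show ?thesis using assms by (simp add: div_mem_eq_image card_image card_cartesian_product)
qed

text \<open>Put \<open>N = (a + 1) * k\<close>. In degree \<open>m * (N + 1) - 1\<close>, the pairs
  above the grid exponent for \<open>s\<close> are exactly those with \<open>p div m = s\<close>, so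
  only quotients off the grid give new generators. The bound \<open>p div m \<le> N\<close> keeps
  the subtraction exact.\<close>

definition minimal_exponents :: "nat \<Rightarrow> nat \<Rightarrow> nat \<Rightarrow> (nat \<times> nat) set"
  where "minimal_exponents a m k =
    (\<lambda>s. (m * s, m * ((a + 1) * k - s))) ` grid a k
    \<union> (\<lambda>p. (p, m * ((a + 1) * k + 1) - 1 - p)) ` {p. p div m \<in> {..(a + 1) * k} - grid a k}"

lemma less_of_div_le:
  assumes "p div m \<le> N" "m \<ge> 1"
  shows "p < m * (N + (1::nat))"
  using assms by (metis add.commute less_Suc_eq_le div_less_iff_less_mult mult.commute plus_1_eq_Suc zero_less_one less_le_trans)

lemma card_minimal_exponents:
  assumes "m \<ge> 2"
  shows "card (minimal_exponents a m k)
    = card (grid a k) + m * ((a + 1) * k + 1 - card (grid a k))"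
proof -
  define N where "N = (a + 1) * k"
  let ?f = "\<lambda>s. (m * s, m * (N - s))" and ?g = "\<lambda>p. (p, m * (N + 1) - 1 - p)"
  let ?P = "{p. p div m \<in> {..N} - grid a k}"
  have "inj_on ?f (grid a k)" using assms by (auto simp: inj_on_def)
  moreover have "inj_on ?g ?P" by (auto simp: inj_on_def)
  \<comment> \<open>A common value would have \<open>p = m * s\<close>, whose quotient
    \<open>s\<close> is in the grid.\<close>
  moreover have "?f ` grid a k \<inter> ?g ` ?P = {}" using assms by auto
  moreover have "finite ?P" using assms by (intro finite_div_mem) simp_all
  moreover have "card ?P = m * (N + 1 - card (grid a k))"
    using card_div_mem[of m "{..N} - grid a k"] grid_subset_atMost[of a k] assms
    by (simp add: card_Diff_subset finite_grid N_def)
  ultimately show ?thesis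
    unfolding minimal_exponents_def N_def[symmetric]
    by (simp add: card_Un_disjoint finite_grid card_image)
qed

text \<open>A high-degree exponent lies above one of degree exactly \<open>m * (N + 1) - 1\<close>,
  which is itself listed or, if its quotient is in the grid, lies above a grid exponent.\<close>

lemma minimal_exponents_plus_UNIV:
  assumes "m \<ge> 1"
  shows "minimal_exponents a m k + UNIV = exponents a m k"
proof -
  define N where "N = (a + 1) * k"
  have "(p, q) \<in> minimal_exponents a m k + UNIV \<longleftrightarrow> (p, q) \<in> exponents a m k" for p q
  proof
    assume "(p, q) \<in> minimal_exponents a m k + UNIV"
    then consider s where "s \<in> grid a k" "m * s \<le> p" "m * (N - s) \<le> q"
      | r where "r div m \<le> N" "r \<le> p" "m * (N + 1) - 1 - r \<le> q"
      unfolding mem_plus_UNIV_iff minimal_exponents_def N_def by fastforce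
    then show "(p, q) \<in> exponents a m k"
    proof cases
      case 1
      then show ?thesis unfolding exponents_def N_def by blast
    next
      case 2
      then have "m * (N + 1) \<le> p + q + 1" by linarith
      then show ?thesis unfolding exponents_def N_def by blast
    qed
  next
    assume "(p, q) \<in> exponents a m k"
    then consider s where "s \<in> grid a k" "m * s \<le> p" "m * (N - s) \<le> q"
      | "m * (N + 1) \<le> p + q + 1"
      unfolding exponents_def N_def by auto
    then show "(p, q) \<in> minimal_exponents a m k + UNIV"
    proof cases
      case 1
      then show ?thesis
        unfolding mem_plus_UNIV_iff minimal_exponents_def N_def by fastforce
    next
      case 2
      \<comment> \<open>The cap makes \<open>(r, m * (N + 1) - 1 - r)\<close> a pair of exactly this
        degree below \<open>(p, q)\<close>.\<close>
      define r where "r = min p (m * (N + 1) - 1)"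
      have "m * (N + 1) \<ge> 1" using assms by simp
      then have r: "r \<le> p" "m * (N + 1) - 1 - r \<le> q" "r < m * (N + 1)"
        using 2 unfolding r_def by linarith+
      have rN: "r div m \<le> N"
        using r(3) assms by (metis Suc_eq_plus1 less_Suc_eq_le less_mult_imp_div_less mult.commute)
      show ?thesis
      proof (cases "r div m \<in> grid a k")
        case False
        then show ?thesis
          using r rN unfolding mem_plus_UNIV_iff minimal_exponents_def N_def by fastforce
      next
        case True
        define s where "s = r div m"
        have s: "m * s \<le> r" "r + 1 \<le> m * s + m"
          using assms mod_less_divisor[of m r] mult_div_mod_eq[of m r] unfolding s_def by linarith+
        have "m * (N - s) + m * s = m * N"
          using rN unfolding s_def by (simp flip: distrib_left)
        then have "m * (N - s) \<le> m * (N + 1) - 1 - r" using s by simp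
        then have "m * s \<le> p" "m * (N - s) \<le> q" using s r by linarith+
        then show ?thesis using True
          unfolding mem_plus_UNIV_iff minimal_exponents_def N_def s_def by fastforce
      qed
    qed
  qed
  then show ?thesis by auto
qed

text \<open>Exponents of degree \<open>m * N\<close> are minimal by degree. One of degree
  \<open>m * (N + 1) - 1\<close> with quotient off the grid has no grid exponent below it, so
  \<open>v\<close> already has the same degree.\<close>

lemma minimal_exponents_minimal:
  assumes m: "m \<ge> 2" and g: "g \<in> minimal_exponents a m k"
    and v: "v \<in> exponents a m k" and guv: "g = u + v"
  shows "u = 0"
proof -
  define N where "N = (a + 1) * k"
  obtain p q where vpq: "v = (p, q)" by (cases v)
  obtain x y where u: "u = (x, y)" by (cases u)
  have deg: "m * N \<le> p + q" using exponents_degree[of p q a m k] v m by (simp add: vpq N_def)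
  consider s where "s \<in> grid a k" "x + p = m * s" "y + q = m * (N - s)"
    | r where "r div m \<le> N" "r div m \<notin> grid a k" "x + p = r" "y + q = m * (N + 1) - 1 - r"
    using g unfolding guv u vpq minimal_exponents_def N_def by auto
  then show ?thesis
  proof cases
    case 1
    have "m * s + m * (N - s) = m * N"
      using grid_le[OF 1(1)] unfolding N_def[symmetric] by (simp flip: distrib_left)
    then have "x + y = 0" using deg 1 by linarith
    then show ?thesis by (simp add: u zero_prod_def)
  next
    case 2
    have "r < m * (N + 1)" using less_of_div_le 2(1) m by simp
    then have sum: "x + p + (y + q) + 1 = m * (N + 1)" using 2 by linarith
    \<comment> \<open>The two coordinate bounds would squeeze \<open>r\<close> into the block of
      \<open>s\<close>, so that \<open>r div m = s\<close>.\<close>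
    have "\<not> (m * s \<le> p \<and> m * (N - s) \<le> q)" if s: "s \<in> grid a k" for s
    proof
      assume *: "m * s \<le> p \<and> m * (N - s) \<le> q"
      have "m * s + m * (N - s) = m * N"
        using grid_le[OF s] unfolding N_def[symmetric] by (simp flip: distrib_left)
      then have "m * s \<le> r" "r < m * s + m" using * sum 2 by auto
      then have "r div m = s" by (metis add.commute div_nat_eqI mult.commute mult_Suc)
      then show False using s 2 by simp
    qed
    then have "m * (N + 1) \<le> p + q + 1"
      using v unfolding vpq exponents_def N_def by auto
    then have "x + y = 0" using sum by linarith
    then show ?thesis by (simp add: u zero_prod_def)
  qed
qed

lemma min_gens_I_am_power:
  assumes "m \<ge> 2" "a \<ge> 1"
  shows "min_gens (ideal_power (I_am a m :: 'k::field poly2 set) k)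
    = card (grid a k) + m * ((a + 1) * k + 1 - card (grid a k))"
proof -
  have "finite (minimal_exponents a m k)"
    unfolding minimal_exponents_def using assms
    by (intro finite_UnI finite_imageI finite_grid finite_div_mem) simp_all
  then have "min_gens (monomial_ideal (minimal_exponents a m k + UNIV) :: 'k poly2 set)
      = card (minimal_exponents a m k)"
    using minimal_exponents_minimal[OF assms(1)] assms
    by (intro min_gens_monomial_ideal) (auto simp: minimal_exponents_plus_UNIV)
  then show ?thesis
    using assms by (simp add: minimal_exponents_plus_UNIV ideal_power_I_am card_minimal_exponents)
qed

theorem corollary2p10:
  fixes b :: nat
  assumes "b > 0"
  shows "\<exists>b0 a m :: nat. b0 \<ge> 1 \<and> a \<ge> 3 \<and> m \<ge> 1 \<and>
    (\<forall>k. b0 \<le> k \<and> k \<le> b0 + b - 1 \<longrightarrow>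
      min_gens (ideal_power (I_am a m :: 'k::field poly2 set) k)
        > min_gens (ideal_power (I_am a m :: 'k poly2 set) (k + 1))) \<and>
    (\<forall>k. k \<ge> b0 + b \<longrightarrow>
      min_gens (ideal_power (I_am a m :: 'k poly2 set) k)
        < min_gens (ideal_power (I_am a m :: 'k poly2 set) (k + 1)))"
proof -
  \<comment> \<open>The witness for \<open>b0\<close> is \<open>b\<close>:
    \<open>2 * k + 1 \<ge> a\<close> means \<open>k \<ge> b\<close>, and \<open>k + 1 < a\<close>
    means \<open>k < 2 * b\<close>, which leaves exactly \<open>b\<close> drops. The value of
    \<open>m\<close> is the least one above \<open>a + 2\<close>.\<close>
  define a where "a = 2 * b + 1"
  define m where "m = a + 3"
  define \<mu> where "\<mu> k = min_gens (ideal_power (I_am a m :: 'k poly2 set) k)" for k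
  have am: "m \<ge> 2" "a \<ge> 1" by (auto simp: a_def m_def)
  have gens: "\<mu> k = card (grid a k) + m * ((a + 1) * k + 1 - card (grid a k))" for k
    unfolding \<mu>_def using am by (rule min_gens_I_am_power)
  have small: "int (\<mu> k) = (int k + 1)\<^sup>2 + int m * ((int a + 1) * int k + 1 - (int k + 1)\<^sup>2)"
    if "k < a" for k
  proof -
    \<comment> \<open>This makes the subtraction in \<open>gens\<close> exact, so that it carries
      over to the integers.\<close>
    have "(k + 1)\<^sup>2 \<le> (a + 1) * k + 1"
      using card_mono[OF _ grid_subset_atMost, of a k] card_grid_small[OF that] by simp
    then show ?thesis
      by (simp only: gens card_grid_small[OF that] of_nat_add of_nat_mult of_nat_diff
          of_nat_power of_nat_1)
  qed
  \<comment> \<open>Since \<open>b + b = a - 1\<close>, the grid is full here and the term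
    multiplied by \<open>m\<close> vanishes.\<close>
  have large: "\<mu> k = (a + 1) * k + 1" if "k \<ge> b + b" for k
    using card_grid_large[of a k] am that by (simp add: gens a_def)
  have drop: "((K + 1)\<^sup>2 + M * ((A + 1) * K + 1 - (K + 1)\<^sup>2))
      - ((K + 1 + 1)\<^sup>2 + M * ((A + 1) * (K + 1) + 1 - (K + 1 + 1)\<^sup>2))
      = (M - 1) * (2 * K + 3) - M * (A + 1)" for A K M :: int
    by algebra
  have "\<mu> k > \<mu> (k + 1)" if k: "b \<le> k" "k \<le> b + b - 1" for k
  proof -
    have "k < a" "k + 1 < a" using k assms by (auto simp: a_def)
    then have "int (\<mu> k) - int (\<mu> (k + 1))
        = (int m - 1) * (2 * int k + 3) - int m * (int a + 1)"
      by (simp only: small of_nat_add of_nat_1 drop)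
    \<comment> \<open>From \<open>k \<ge> b\<close> follows \<open>2 * k + 3 \<ge> a + 2\<close>,
      and \<open>m - 1 = a + 2\<close>; the subtracted \<open>m * (a + 1)\<close> is one less than
      the square of \<open>a + 2\<close>.\<close>
    moreover have "(int a + 2) * (int a + 2) \<le> (int m - 1) * (2 * int k + 3)"
      using k by (intro mult_mono) (auto simp: m_def a_def)
    moreover have "int m * (int a + 1) < (int a + 2) * (int a + 2)"
      by (simp add: m_def algebra_simps)
    ultimately show ?thesis by linarith
  qed
  moreover have "\<mu> k < \<mu> (k + 1)" if "k \<ge> b + b" for k
    using that by (simp add: large)
  moreover have "b \<ge> 1" "a \<ge> 3" "m \<ge> 1" using assms by (auto simp: a_def m_def)
  ultimately show ?thesis unfolding \<mu>_def by blast
qed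

end
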